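(* Let $C$ be a closed bounded convex set of a real Banach space $X$ containing at least two points. If $C$ is separable, then (i) $C_{N,[C]}\neq\emptyset$; (ii) for every $e\in C_{N,[C]}$, the $(C,e)$-generating space $(X_e,\|\cdot\|_e)$ is linearly isometric to a closed subspace of $\ell_\infty$.
   Context: $[C]$ denotes the norm closure of $\operatorname{span}C$ in $X$. A point $x\in C$ is a support point of $C$ with respect to $[C]$ if there is a nonzero $x^*\in [C]^*$ with $\langle x^*,x\rangle=\max\{\langle x^*,y\rangle:y\in C\}$; $C_{N,[C]}$ is the set of points of $C$ that are not support points of $C$ with respect to $[C]$. For $e\in C$ put $C_e=\bigcup_{\lambda>0}\lambda(C-e)$. The $(C,e)$-generating space is $X_e=C_e\cap(-C_e)$ with the norm $\|x\|_e=\inf\{\lambda>0:\lambda^{-1}x\in (C-e)\cap(e-C)\}$.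
   Formalization: Support points are defined by functionals in [C]* that are not constant on C, instead of merely nonzero; with "nonzero", (i) fails whenever 0 is not in the closed affine hull of C (e.g. the segment from (1,0) to (0,1) in the plane), and otherwise the two notions agree. *)

theory Defs
  imports "HOL-Analysis.Analysis"
begin

definition closed_span :: "'a::real_normed_vector set \<Rightarrow> 'a set" where
  "closed_span C = closure (span C)"

text \<open>Membership in the dual of a subspace \<open>S\<close>; values outside \<open>S\<close> are irrelevant.\<close>

definition bounded_functional_on :: "'a::real_normed_vector set \<Rightarrow> ('a \<Rightarrow> real) \<Rightarrow> bool" where
  "bounded_functional_on S f \<longleftrightarrow>
     (\<forall>x\<in>S. \<forall>y\<in>S. f (x + y) = f x + f y) \<and>
     (\<forall>c. \<forall>x\<in>S. f (c *\<^sub>R x) = c * f x) \<and>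
     (\<exists>K. \<forall>x\<in>S. \<bar>f x\<bar> \<le> K * norm x)"

text \<open>
  The supporting functional is required to be nonconstant on \<open>C\<close>, which is the translation-invariant
  form of being nonzero on \<open>closed_span C\<close>. The two agree if the closed affine hull of \<open>C\<close>
  contains 0, in particular if \<open>0 \<in> C\<close> (lemma \<open>support_point_iff_nonzero\<close>). Otherwise a
  functional that is nonzero but constant on \<open>C\<close> would make every point of \<open>C\<close> a support point,
  even for a segment in the plane (lemma \<open>nonzero_functional_segment\<close>).
\<close>

definition support_point :: "'a::real_normed_vector set \<Rightarrow> 'a \<Rightarrow> bool" where
  "support_point C x \<longleftrightarrow> x \<in> C \<and>
     (\<exists>f. bounded_functional_on (closed_span C) f \<and>
          (\<exists>y\<in>C. f y \<noteq> f x) \<and> (\<forall>y\<in>C. f y \<le> f x))"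

definition nonsupport_points :: "'a::real_normed_vector set \<Rightarrow> 'a set" where
  "nonsupport_points C = {x \<in> C. \<not> support_point C x}"

definition generated_cone :: "'a::real_normed_vector set \<Rightarrow> 'a \<Rightarrow> 'a set" where
  "generated_cone C e = (\<Union>l\<in>{0<..}. (\<lambda>c. l *\<^sub>R (c - e)) ` C)"

definition generating_space :: "'a::real_normed_vector set \<Rightarrow> 'a \<Rightarrow> 'a set" where
  "generating_space C e = generated_cone C e \<inter> uminus ` generated_cone C e"

definition generating_norm :: "'a::real_normed_vector set \<Rightarrow> 'a \<Rightarrow> 'a \<Rightarrow> real" where
  "generating_norm C e x =
     Inf {l. 0 < l \<and> inverse l *\<^sub>R x \<in> (\<lambda>c. c - e) ` C \<inter> (\<lambda>c. e - c) ` C}"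

text \<open>\<open>V\<close> carries the norm \<open>nrm\<close>, \<open>W\<close> the norm of its ambient space.\<close>

definition linearly_isometric ::
    "'a::real_vector set \<Rightarrow> ('a \<Rightarrow> real) \<Rightarrow> 'b::real_normed_vector set \<Rightarrow> bool" where
  "linearly_isometric V nrm W \<longleftrightarrow> subspace V \<and> subspace W \<and>
     (\<exists>T. (\<forall>x\<in>V. \<forall>y\<in>V. T (x + y) = T x + T y) \<and>
          (\<forall>c. \<forall>x\<in>V. T (c *\<^sub>R x) = c *\<^sub>R T x) \<and>
          (\<forall>x\<in>V. norm (T x) = nrm x) \<and> T ` V = W)"

text \<open>As \<open>nat\<close> is discrete, its bounded continuous functions are the bounded sequences,
  with the supremum norm.\<close>

type_synonym l_infinity = "nat \<Rightarrow>\<^sub>C real"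

lemma subspace_closed_span: "subspace (closed_span C)"
proof (rule subspaceI)
  show "0 \<in> closed_span C"
    unfolding closed_span_def by (meson closure_subset span_zero subsetD)
next
  fix x y assume "x \<in> closed_span C" "y \<in> closed_span C"
  then obtain s t where "\<And>n. s n \<in> span C" "s \<longlonglongrightarrow> x" "\<And>n. t n \<in> span C" "t \<longlonglongrightarrow> y"
    unfolding closed_span_def closure_sequential by blast
  then show "x + y \<in> closed_span C"
    unfolding closed_span_def closure_sequential
    by (intro exI[of _ "\<lambda>n. s n + t n"]) (auto intro: span_add tendsto_add)
next
  fix c x assume "x \<in> closed_span C"
  then obtain s where "\<And>n. s n \<in> span C" "s \<longlonglongrightarrow> x"
    unfolding closed_span_def closure_sequential by blast
  then show "c *\<^sub>R x \<in> closed_span C"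
    unfolding closed_span_def closure_sequential
    by (intro exI[of _ "\<lambda>n. c *\<^sub>R s n"]) (auto intro: span_scale tendsto_scaleR)
qed

lemma bounded_functional_on_0:
  assumes "bounded_functional_on (closed_span C) f"
  shows "f 0 = 0"
proof -
  have "f (0 *\<^sub>R 0) = 0 * f 0"
    using assms subspace_0[OF subspace_closed_span[of C]] unfolding bounded_functional_on_def by blast
  then show ?thesis by simp
qed

lemma bounded_functional_on_constant_affine:
  assumes f: "bounded_functional_on (closed_span C) f"
    and const: "\<And>y. y \<in> C \<Longrightarrow> f y = k"
    and z: "z \<in> closure (affine hull C)"
  shows "f z = k"
proof -
  let ?S = "closed_span C"
  have sub: "subspace ?S"
    by (rule subspace_closed_span)
  have CS: "C \<subseteq> ?S"
    unfolding closed_span_def by (meson closure_subset order_trans span_superset)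
  have add: "f (x + y) = f x + f y" if "x \<in> ?S" "y \<in> ?S" for x y
    using f that unfolding bounded_functional_on_def by blast
  have scale: "f (c *\<^sub>R x) = c * f x" if "x \<in> ?S" for c x
    using f that unfolding bounded_functional_on_def by blast
  obtain K where K: "\<And>x. x \<in> ?S \<Longrightarrow> \<bar>f x\<bar> \<le> K * norm x"
    using f unfolding bounded_functional_on_def by blast
  have aff: "affine hull C \<subseteq> {x \<in> ?S. f x = k}"
  proof (rule hull_minimal)
    show "affine {x \<in> ?S. f x = k}"
      unfolding affine_def
    proof (intro ballI allI impI)
      fix x y and u v :: real
      assume x: "x \<in> {x \<in> ?S. f x = k}" and y: "y \<in> {x \<in> ?S. f x = k}" and uv: "u + v = 1"
      have "u *\<^sub>R x \<in> ?S" "v *\<^sub>R y \<in> ?S"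
        using x y sub by (auto intro: subspace_scale)
      moreover have "u * k + v * k = k"
        using uv by (metis distrib_right mult_1)
      ultimately show "u *\<^sub>R x + v *\<^sub>R y \<in> {x \<in> ?S. f x = k}"
        using x y sub by (auto simp: add scale intro: subspace_add)
    qed
  qed (use CS const in auto)
  obtain s where s: "\<And>n. s n \<in> affine hull C" "s \<longlonglongrightarrow> z"
    using z by (auto simp: closure_sequential)
  have zS: "z \<in> ?S"
    using z closure_mono[OF affine_hull_subset_span[of C]] unfolding closed_span_def by blast
  have bound: "\<bar>f z - k\<bar> \<le> K * norm (z - s n)" for n
  proof -
    have sn: "s n \<in> ?S" "f (s n) = k" using aff s(1) by auto
    have "z - s n \<in> ?S" using zS sn sub by (auto intro: subspace_diff)
    moreover from this have "f z = f (z - s n) + f (s n)"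
      using add[of "z - s n" "s n"] sn by simp
    ultimately show ?thesis using K[of "z - s n"] sn by simp
  qed
  have "(\<lambda>n. K * norm (z - s n)) \<longlonglongrightarrow> K * norm (z - z)"
    by (intro tendsto_intros s)
  then have "\<bar>f z - k\<bar> \<le> K * norm (z - z)"
    by (rule LIMSEQ_le_const) (use bound in auto)
  then show ?thesis by simp
qed

lemma bounded_functional_on_zero:
  assumes f: "bounded_functional_on (closed_span C) f"
    and zero: "\<And>y. y \<in> C \<Longrightarrow> f y = 0" and z: "z \<in> closed_span C"
  shows "f z = 0"
proof -
  have S: "closed_span (insert 0 C) = closed_span C"
    by (simp add: closed_span_def)
  have f': "bounded_functional_on (closed_span (insert 0 C)) f"
    using f S by simp
  have zero': "f y = 0" if "y \<in> insert 0 C" for y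
    using that zero bounded_functional_on_0[OF f] by blast
  have "z \<in> closure (affine hull (insert 0 C))"
    using z by (simp add: closed_span_def affine_hull_span_0 hull_inc)
  from bounded_functional_on_constant_affine[OF f' _ this, of 0] zero' show ?thesis
    by blast
qed

lemma support_point_iff_nonzero:
  assumes "0 \<in> closure (affine hull C)"
  shows "support_point C x \<longleftrightarrow> x \<in> C \<and>
     (\<exists>f. bounded_functional_on (closed_span C) f \<and>
          (\<exists>z\<in>closed_span C. f z \<noteq> 0) \<and> (\<forall>y\<in>C. f y \<le> f x))"
proof -
  have CS: "C \<subseteq> closed_span C"
    unfolding closed_span_def by (meson closure_subset order_trans span_superset)
  have "(\<exists>y\<in>C. f y \<noteq> f x) \<longleftrightarrow> (\<exists>z\<in>closed_span C. f z \<noteq> 0)"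
    if f: "bounded_functional_on (closed_span C) f" and x: "x \<in> C" for f
  proof
    assume "\<exists>y\<in>C. f y \<noteq> f x"
    then obtain y where "y \<in> C" "f y \<noteq> 0 \<or> f x \<noteq> 0" by fastforce
    then show "\<exists>z\<in>closed_span C. f z \<noteq> 0" using CS x by blast
  next
    assume nz: "\<exists>z\<in>closed_span C. f z \<noteq> 0"
    show "\<exists>y\<in>C. f y \<noteq> f x"
    proof (rule ccontr)
      assume "\<not> (\<exists>y\<in>C. f y \<noteq> f x)"
      then have c: "\<And>y. y \<in> C \<Longrightarrow> f y = f x" by blast
      have "f 0 = f x"
        by (rule bounded_functional_on_constant_affine[OF f c assms])
      moreover have "f 0 = 0"
        by (rule bounded_functional_on_0[OF f])
      ultimately have "\<And>y. y \<in> C \<Longrightarrow> f y = 0" using c by simp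
      then show False
        using bounded_functional_on_zero[OF f] nz by blast
    qed
  qed
  then show ?thesis unfolding support_point_def by blast
qed

lemma nonzero_functional_segment:
  defines "C \<equiv> closed_segment (1, 0) (0, 1) :: (real \<times> real) set"
  assumes "x \<in> C"
  shows "\<exists>f. bounded_functional_on (closed_span C) f \<and>
          (\<exists>z\<in>closed_span C. f z \<noteq> 0) \<and> (\<forall>y\<in>C. f y \<le> f x)"
proof -
  let ?f = "\<lambda>p::real \<times> real. fst p + snd p"
  have one: "?f y = 1" if "y \<in> C" for y
    using that by (auto simp: C_def closed_segment_def)
  have "\<bar>?f p\<bar> \<le> 2 * norm p" for p
    using norm_fst_le[of "fst p" "snd p"] norm_snd_le[of "snd p" "fst p"] by simp
  then have "\<exists>K. \<forall>p\<in>closed_span C. \<bar>?f p\<bar> \<le> K * norm p"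
    by blast
  then have "bounded_functional_on (closed_span C) ?f"
    unfolding bounded_functional_on_def by (simp add: algebra_simps)
  moreover have "x \<in> closed_span C"
    using assms(2) unfolding closed_span_def by (meson closure_subset span_superset subsetD)
  moreover have "?f x \<noteq> 0" "\<forall>y\<in>C. ?f y \<le> ?f x"
    using one assms(2) by auto
  ultimately show ?thesis
    by blast
qed

end

theory Submission
  imports Defs
begin

text \<open>
  For (i), let \<open>e = \<Sum>n. 2\<^bsup>-n-1\<^esup> c\<^sub>n\<close> with \<open>c\<^sub>n\<close> dense in \<open>C\<close>: a functional attaining its
  maximum over \<open>C\<close> at this average takes the same value at every \<open>c\<^sub>n\<close>, hence is constant on \<open>C\<close>.
  For (ii), the unit ball of \<open>X\<^sub>e\<close> is \<open>B = (C - e) \<inter> (e - C)\<close>, which is closed in \<open>X\<close>, so its gauge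
  is the supremum over \<open>k\<close> of the gauges \<open>p\<^sub>k\<close> of \<open>B\<close> thickened by \<open>1/k\<close>. Each \<open>p\<^sub>k\<close> is norm continuous
  on \<open>X\<close>, so Hahn-Banach functionals touching \<open>p\<^sub>k\<close> at countably many points determine it on
  \<open>X\<^sub>e\<close>. The resulting isometry has closed range because a closed bounded \<open>B\<close> makes \<open>X\<^sub>e\<close> complete.
\<close>

section \<open>Sublinear functionals and the Hahn-Banach theorem\<close>

text \<open>Homogeneity is demanded only as an inequality for positive factors. Applying it to the
  inverse factor turns it into an equality, and the factor 2 at the origin then forces
  \<open>p 0 = 0\<close>.\<close>

definition sublinear :: "('a::real_vector \<Rightarrow> real) \<Rightarrow> bool" where
  "sublinear p \<longleftrightarrow> (\<forall>x y. p (x + y) \<le> p x + p y) \<and> (\<forall>t>0. \<forall>x. p (t *\<^sub>R x) \<le> t * p x)"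

lemma sublinear_add: "sublinear p \<Longrightarrow> p (x + y) \<le> p x + p y"
  by (simp add: sublinear_def)

lemma sublinear_scale_pos:
  assumes "sublinear p" "t > 0"
  shows "p (t *\<^sub>R x) = t * p x"
proof (rule antisym)
  show "p (t *\<^sub>R x) \<le> t * p x"
    using assms by (simp add: sublinear_def)
  have "p (inverse t *\<^sub>R (t *\<^sub>R x)) \<le> inverse t * p (t *\<^sub>R x)"
    using assms unfolding sublinear_def by (meson inverse_positive_iff_positive)
  then show "t * p x \<le> p (t *\<^sub>R x)"
    using assms by (simp add: field_simps)
qed

lemma sublinear_zero: "sublinear p \<Longrightarrow> p 0 = 0"
  using sublinear_scale_pos[of p 2 0] by simp

lemma sublinear_scale: "sublinear p \<Longrightarrow> t \<ge> 0 \<Longrightarrow> p (t *\<^sub>R x) = t * p x"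
  by (cases "t = 0") (simp_all add: sublinear_zero sublinear_scale_pos)

lemma sublinear_neg: "sublinear p \<Longrightarrow> - p (- x) \<le> p x"
  using sublinear_add[of p x "- x"] by (simp add: sublinear_zero)

text \<open>The functional \<open>q x = inf {p (x + t y) - t p y : t \<ge> 0}\<close> works:
  \<open>t = 0\<close> gives the first bound and \<open>t = 1\<close> the second. The second bound
  yields additivity when \<open>p\<close> is minimal, and touching at a prescribed point in
  general.\<close>

lemma sublinear_shrink:
  fixes p :: "'a::real_vector \<Rightarrow> real"
  assumes p: "sublinear p"
  obtains q where "sublinear q" "\<And>x. q x \<le> p x" "\<And>x. q x \<le> p (x + y) - p y"
proof -
  define q where "q x = (INF t\<in>{0..}. p (x + t *\<^sub>R y) - t * p y)" for x
  \<comment> \<open>This lower bound, independent of \<open>t\<close>, keeps the infimum defining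
    \<open>q\<close> from running over a set unbounded below. It comes from splitting
    \<open>t y\<close> as \<open>(x + t y) + (- x)\<close>.\<close>
  have lower: "- p (- x) \<le> p (x + t *\<^sub>R y) - t * p y" if "t \<ge> 0" for x t
    using sublinear_add[OF p, of "x + t *\<^sub>R y" "- x"] sublinear_scale[OF p that, of y] by simp
  have bdd: "bdd_below ((\<lambda>t. p (x + t *\<^sub>R y) - t * p y) ` {0..})" for x
    using lower by (intro bdd_belowI2) auto
  have q_le: "q x \<le> p (x + t *\<^sub>R y) - t * p y" if "t \<ge> 0" for x t
    unfolding q_def using that by (intro cINF_lower bdd) auto
  have q_ge: "m \<le> q x" if "\<And>t. t \<ge> 0 \<Longrightarrow> m \<le> p (x + t *\<^sub>R y) - t * p y" for x m
    unfolding q_def using that by (intro cINF_greatest) auto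
  have "q (x + z) \<le> q x + q z" for x z
  proof -
    \<comment> \<open>The two infima on the right are removed one after the other: parameters
      \<open>s\<close> for \<open>x\<close> and \<open>t\<close> for \<open>z\<close> are matched by
      \<open>s + t\<close> for \<open>x + z\<close>.\<close>
    have "q (x + z) - q z \<le> q x"
    proof (rule q_ge)
      fix s :: real assume s: "s \<ge> 0"
      have "q (x + z) - (p (x + s *\<^sub>R y) - s * p y) \<le> q z"
      proof (rule q_ge)
        fix t :: real assume t: "t \<ge> 0"
        have "q (x + z) \<le> p ((x + z) + (s + t) *\<^sub>R y) - (s + t) * p y"
          using s t by (intro q_le) auto
        also have "(x + z) + (s + t) *\<^sub>R y = (x + s *\<^sub>R y) + (z + t *\<^sub>R y)"
          by (simp add: algebra_simps)
        also have "p \<dots> \<le> p (x + s *\<^sub>R y) + p (z + t *\<^sub>R y)"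
          by (rule sublinear_add[OF p])
        finally show "q (x + z) - (p (x + s *\<^sub>R y) - s * p y) \<le> p (z + t *\<^sub>R y) - t * p y"
          by (simp add: algebra_simps)
      qed
      then show "q (x + z) - q z \<le> p (x + s *\<^sub>R y) - s * p y" by simp
    qed
    then show ?thesis by simp
  qed
  moreover have "q (c *\<^sub>R x) \<le> c * q x" if c: "c > 0" for c x
  proof -
    have "q (c *\<^sub>R x) / c \<le> q x"
    proof (rule q_ge)
      fix t :: real assume t: "t \<ge> 0"
      have "q (c *\<^sub>R x) \<le> p (c *\<^sub>R x + (c * t) *\<^sub>R y) - (c * t) * p y"
        using c t by (intro q_le) auto
      also have "c *\<^sub>R x + (c * t) *\<^sub>R y = c *\<^sub>R (x + t *\<^sub>R y)"
        by (simp add: algebra_simps)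
      also have "p \<dots> = c * p (x + t *\<^sub>R y)"
        by (rule sublinear_scale_pos[OF p c])
      finally show "q (c *\<^sub>R x) / c \<le> p (x + t *\<^sub>R y) - t * p y"
        using c by (simp add: field_simps)
    qed
    then show ?thesis using c by (simp add: field_simps)
  qed
  ultimately have "sublinear q" by (simp add: sublinear_def)
  then show thesis
    using that[of q] q_le[of 0] q_le[of 1] by simp
qed

text \<open>Zorn's lemma applies because the pointwise infimum of a nonempty chain of sublinear
  functionals below \<open>p\<close> is again sublinear and finite.\<close>

lemma exists_minimal_sublinear:
  fixes p :: "'a::real_vector \<Rightarrow> real"
  assumes p: "sublinear p"
  obtains q where "sublinear q" "q \<le> p" "\<And>r. sublinear r \<Longrightarrow> r \<le> q \<Longrightarrow> r = q"
proof -
  define A where "A = {q. sublinear q \<and> q \<le> p}"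
  \<comment> \<open>The order is reversed, since \<open>predicate_Zorn\<close> delivers maximal
    elements.\<close>
  let ?P = "\<lambda>f g :: 'a \<Rightarrow> real. g \<le> f"
  have po: "partial_order_on A (relation_of ?P A)"
    by (rule partial_order_on_relation_ofI) auto
  have chain: "\<exists>u\<in>A. \<forall>a\<in>K. ?P a u" if K: "K \<in> Chains (relation_of ?P A)" for K
  proof (cases "K = {}")
    case True
    then show ?thesis using p by (auto simp: A_def)
  next
    case False
    have KA: "K \<subseteq> A" and total: "\<And>f g. f \<in> K \<Longrightarrow> g \<in> K \<Longrightarrow> f \<le> g \<or> g \<le> f"
      using K by (auto simp: Chains_def relation_of_def)
    have sub: "sublinear f" and fp: "f x \<le> p x" if "f \<in> K" for f x
      using KA that by (auto simp: A_def le_fun_def)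
    define u where "u x = (INF f\<in>K. f x)" for x
    have "- p (- x) \<le> f x" if "f \<in> K" for f x
      using sublinear_neg[OF sub[OF that], of x] fp[OF that, of "- x"] by simp
    then have bdd: "bdd_below ((\<lambda>f. f x) ` K)" for x
      by (intro bdd_belowI2)
    have u_le: "u x \<le> f x" if "f \<in> K" for f x
      unfolding u_def using that by (intro cINF_lower bdd)
    have u_ge: "m \<le> u x" if "\<And>f. f \<in> K \<Longrightarrow> m \<le> f x" for x m
      unfolding u_def using that False by (intro cINF_greatest) auto
    \<comment> \<open>This is where the chain condition enters: the smaller of \<open>f\<close> and
      \<open>g\<close> is subadditive and lies below both, so separate infima may be taken over
      \<open>f\<close> and \<open>g\<close>.\<close>
    have mixed: "u (x + y) \<le> f x + g y" if fg: "f \<in> K" "g \<in> K" for f g x y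
    proof -
      obtain h where h: "h \<in> K" "h \<le> f" "h \<le> g"
        using total[OF fg] fg by blast
      have "u (x + y) \<le> h x + h y"
        using u_le[OF h(1)] sublinear_add[OF sub[OF h(1)]] order_trans by blast
      then show ?thesis
        using le_funD[OF h(2), of x] le_funD[OF h(3), of y] by simp
    qed
    have "u (x + y) \<le> u x + u y" for x y
    proof -
      have "u (x + y) - u y \<le> u x"
      proof (rule u_ge)
        fix f assume f: "f \<in> K"
        have "u (x + y) - f x \<le> u y"
          by (rule u_ge) (use mixed[OF f] in \<open>simp add: algebra_simps\<close>)
        then show "u (x + y) - u y \<le> f x" by simp
      qed
      then show ?thesis by simp
    qed
    moreover have "u (t *\<^sub>R x) \<le> t * u x" if t: "t > 0" for t x
    proof -
      have "u (t *\<^sub>R x) / t \<le> u x"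
      proof (rule u_ge)
        fix f assume f: "f \<in> K"
        show "u (t *\<^sub>R x) / t \<le> f x"
          using u_le[OF f, of "t *\<^sub>R x"] t
          by (simp add: sublinear_scale_pos[OF sub[OF f]] field_simps)
      qed
      then show ?thesis using t by (simp add: field_simps)
    qed
    ultimately have "sublinear u" by (simp add: sublinear_def)
    moreover have "u \<le> p"
      using False u_le fp by (metis all_not_in_conv le_funI order_trans)
    ultimately show ?thesis
      using u_le by (auto simp: A_def le_fun_def intro!: bexI[of _ u])
  qed
  obtain q where "q \<in> A" "\<forall>a\<in>A. a \<le> q \<longrightarrow> a = q"
    using predicate_Zorn[OF po chain] by blast
  then show thesis
    using that[of q] by (auto simp: A_def)
qed

text \<open>A minimal sublinear functional is linear: shrinking it along \<open>y\<close> cannot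
  produce anything smaller, so the second bound of \<open>sublinear_shrink\<close> becomes
  superadditivity.\<close>

lemma sublinear_dominates_linear:
  fixes p :: "'a::real_vector \<Rightarrow> real"
  assumes "sublinear p"
  obtains f where "linear f" "\<And>x. f x \<le> p x"
proof -
  obtain q where q: "sublinear q" "q \<le> p" and min: "\<And>r. sublinear r \<Longrightarrow> r \<le> q \<Longrightarrow> r = q"
    using exists_minimal_sublinear[OF assms] by metis
  have add: "q (x + y) = q x + q y" for x y
  proof (rule antisym)
    obtain r where r: "sublinear r" "\<And>x. r x \<le> q x" "\<And>x. r x \<le> q (x + y) - q y"
      using sublinear_shrink[OF q(1), of y] by metis
    then have "r = q" using min by (simp add: le_fun_def)
    then show "q x + q y \<le> q (x + y)" using r(3)[of x] by simp
  qed (rule sublinear_add[OF q(1)])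
  have neg: "q (- x) = - q x" for x
    using add[of x "- x"] sublinear_zero[OF q(1)] by simp
  have "q (t *\<^sub>R x) = t * q x" for t x
  proof (cases "t \<ge> 0")
    case False
    then have "q ((- t) *\<^sub>R x) = (- t) * q x"
      by (intro sublinear_scale[OF q(1)]) simp
    then show ?thesis by (simp add: neg)
  qed (rule sublinear_scale[OF q(1)])
  then have "linear q"
    by (intro linearI) (simp_all add: add)
  then show thesis
    using that q(2) by (simp add: le_fun_def)
qed

text \<open>Shrinking \<open>p\<close> along \<open>a\<close> first gives
  \<open>q (- a) \<le> - p a\<close>. Every linear functional below \<open>q\<close> is then at
  least \<open>p a\<close> at \<open>a\<close>.\<close>

lemma hahn_banach_touching:
  fixes p :: "'a::real_vector \<Rightarrow> real"
  assumes "sublinear p"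
  obtains f where "linear f" "\<And>x. f x \<le> p x" "f a = p a"
proof -
  obtain q where q: "sublinear q" "\<And>x. q x \<le> p x" "\<And>x. q x \<le> p (x + a) - p a"
    using sublinear_shrink[OF assms, of a] by metis
  obtain f where f: "linear f" "\<And>x. f x \<le> q x"
    using sublinear_dominates_linear[OF q(1)] by metis
  have "f (- a) \<le> - p a"
    using f(2)[of "- a"] q(3)[of "- a"] sublinear_zero[OF assms] by simp
  then have "p a \<le> f a"
    by (simp add: linear_neg[OF f(1)])
  then show thesis
    using that[of f] f q(2) order_trans antisym by metis
qed

section \<open>Minkowski gauges\<close>

text \<open>For a convex symmetric \<open>U\<close> containing 0 this is the linear span of
  \<open>U\<close>, the natural domain of its gauge.\<close>

definition absorbed :: "'a::real_vector set \<Rightarrow> 'a set" where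
  "absorbed U = {x. \<exists>l>0. inverse l *\<^sub>R x \<in> U}"

text \<open>As an infimum of reals the gauge has no meaning outside \<open>absorbed U\<close>.\<close>

definition gauge_fun :: "'a::real_vector set \<Rightarrow> 'a \<Rightarrow> real" where
  "gauge_fun U x = Inf {l. 0 < l \<and> inverse l *\<^sub>R x \<in> U}"

lemma gauge_fun_le: "0 < l \<Longrightarrow> inverse l *\<^sub>R x \<in> U \<Longrightarrow> gauge_fun U x \<le> l"
  unfolding gauge_fun_def by (rule cInf_lower) (auto intro!: bdd_belowI[of _ 0])

lemma gauge_fun_nonneg: "x \<in> absorbed U \<Longrightarrow> 0 \<le> gauge_fun U x"
  unfolding gauge_fun_def absorbed_def by (rule cInf_greatest) auto

lemma convex_scale_mem:
  assumes "convex U" "0 \<in> U" "x \<in> U" "0 \<le> t" "t \<le> 1"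
  shows "t *\<^sub>R x \<in> U"
  using convexD[OF assms(1,3,2,4), of "1 - t"] assms(5) by simp

text \<open>Convexity and \<open>0 \<in> U\<close> make the set of admissible \<open>l\<close>
  upward closed, so every number strictly above its infimum is admissible.\<close>

lemma gauge_fun_lessD:
  assumes U: "convex U" "0 \<in> U" and x: "x \<in> absorbed U" and s: "gauge_fun U x < s"
  shows "0 < s" "inverse s *\<^sub>R x \<in> U"
proof -
  show "0 < s" using gauge_fun_nonneg[OF x] s by simp
  have "{l. 0 < l \<and> inverse l *\<^sub>R x \<in> U} \<noteq> {}"
    using x by (auto simp: absorbed_def)
  from cInf_lessD[OF this s[unfolded gauge_fun_def]]
  obtain l where l: "0 < l" "l < s" "inverse l *\<^sub>R x \<in> U" by auto
  have "(l / s) *\<^sub>R (inverse l *\<^sub>R x) \<in> U"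
    using l by (intro convex_scale_mem U l(3)) auto
  moreover have "(l / s) * inverse l = inverse s"
    using l by (simp add: field_simps)
  ultimately show "inverse s *\<^sub>R x \<in> U"
    by (simp only: scaleR_scaleR)
qed

text \<open>The point is the convex combination of \<open>x / l\<close> and \<open>y / m\<close>
  with weights \<open>l / (l + m)\<close> and \<open>m / (l + m)\<close>.\<close>

lemma convex_inverse_scale_add:
  assumes U: "convex U" and "0 < l" "inverse l *\<^sub>R x \<in> U" "0 < m" "inverse m *\<^sub>R y \<in> U"
  shows "inverse (l + m) *\<^sub>R (x + y) \<in> U"
proof -
  have "(l / (l + m)) *\<^sub>R (inverse l *\<^sub>R x) + (m / (l + m)) *\<^sub>R (inverse m *\<^sub>R y) \<in> U"
    using assms by (intro convexD[OF U]) (auto simp: add_divide_distrib[symmetric])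
  moreover have "l / (l + m) * inverse l = inverse (l + m)" "m / (l + m) * inverse m = inverse (l + m)"
    using assms(2,4) by (simp_all add: field_simps)
  ultimately show ?thesis
    by (simp only: scaleR_scaleR scaleR_add_right)
qed

lemma gauge_fun_add:
  assumes U: "convex U" "0 \<in> U" and x: "x \<in> absorbed U" and y: "y \<in> absorbed U"
  shows "gauge_fun U (x + y) \<le> gauge_fun U x + gauge_fun U y"
proof (rule field_le_epsilon)
  fix e :: real assume "e > 0"
  then have "gauge_fun U x < gauge_fun U x + e/2" "gauge_fun U y < gauge_fun U y + e/2"
    by auto
  note gauge_fun_lessD[OF U x this(1)] gauge_fun_lessD[OF U y this(2)]
  then have "gauge_fun U (x + y) \<le> (gauge_fun U x + e/2) + (gauge_fun U y + e/2)"
    by (intro gauge_fun_le convex_inverse_scale_add U) auto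
  then show "gauge_fun U (x + y) \<le> gauge_fun U x + gauge_fun U y + e" by simp
qed

lemma gauge_fun_scale_le:
  assumes x: "x \<in> absorbed U" and t: "t > 0"
  shows "gauge_fun U (t *\<^sub>R x) \<le> t * gauge_fun U x"
proof -
  have "gauge_fun U (t *\<^sub>R x) / t \<le> gauge_fun U x"
    unfolding gauge_fun_def[of U x]
  proof (rule cInf_greatest)
    show "{l. 0 < l \<and> inverse l *\<^sub>R x \<in> U} \<noteq> {}"
      using x by (auto simp: absorbed_def)
    fix l assume "l \<in> {l. 0 < l \<and> inverse l *\<^sub>R x \<in> U}"
    moreover have "inverse (t * l) * t = inverse l"
      using t by (simp add: field_simps)
    ultimately have "gauge_fun U (t *\<^sub>R x) \<le> t * l"
      using t by (intro gauge_fun_le) (simp_all only: scaleR_scaleR mem_Collect_eq mult_pos_pos)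
    then show "gauge_fun U (t *\<^sub>R x) / t \<le> l"
      using t by (simp add: field_simps)
  qed
  then show ?thesis using t by (simp add: field_simps)
qed

lemma gauge_fun_sublinear:
  assumes "convex U" "0 \<in> U" "absorbed U = UNIV"
  shows "sublinear (gauge_fun U)"
  using assms by (simp add: sublinear_def gauge_fun_add gauge_fun_scale_le)

lemma gauge_fun_uminus:
  assumes "\<And>x. x \<in> U \<Longrightarrow> - x \<in> U"
  shows "gauge_fun U (- x) = gauge_fun U x"
proof -
  have "- z \<in> U \<longleftrightarrow> z \<in> U" for z
    using assms[of z] assms[of "- z"] by auto
  then show ?thesis by (simp add: gauge_fun_def)
qed

lemma gauge_fun_antimono:
  assumes "U \<subseteq> U'" "x \<in> absorbed U"
  shows "gauge_fun U' x \<le> gauge_fun U x"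
  unfolding gauge_fun_def[of U]
  using assms by (intro cInf_greatest) (auto simp: absorbed_def intro!: gauge_fun_le)

lemma subspace_absorbed:
  assumes U: "convex U" "0 \<in> U" and sym: "\<And>x. x \<in> U \<Longrightarrow> - x \<in> U"
  shows "subspace (absorbed U)"
proof (rule subspaceI)
  show "0 \<in> absorbed U"
    using U by (auto simp: absorbed_def intro: exI[of _ 1])
  fix x y assume x: "x \<in> absorbed U"
  then obtain l where l: "0 < l" "inverse l *\<^sub>R x \<in> U" by (auto simp: absorbed_def)
  {
    assume "y \<in> absorbed U"
    then obtain m where "0 < m" "inverse m *\<^sub>R y \<in> U" by (auto simp: absorbed_def)
    then show "x + y \<in> absorbed U"
      using l convex_inverse_scale_add[OF U(1) l]
      unfolding absorbed_def by (metis (mono_tags, lifting) add_pos_pos mem_Collect_eq)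
  }
  fix c :: real
  \<comment> \<open>The summand 1 keeps the scale positive for \<open>c = 0\<close>. The remaining
    factor has absolute value at most 1, and its sign is absorbed by the symmetry of
    \<open>U\<close>.\<close>
  have "inverse (l * (\<bar>c\<bar> + 1)) *\<^sub>R (c *\<^sub>R x) \<in> U"
  proof -
    define t where "t = \<bar>c\<bar> / (\<bar>c\<bar> + 1)"
    have t: "t *\<^sub>R (inverse l *\<^sub>R x) \<in> U"
      unfolding t_def using l by (intro convex_scale_mem U l) auto
    have eq: "inverse (l * (\<bar>c\<bar> + 1)) * c = (if c \<ge> 0 then t * inverse l else - (t * inverse l))"
      using l(1) by (simp add: t_def divide_inverse)
    show ?thesis
      unfolding scaleR_scaleR eq using t sym[OF t] by simp
  qed
  then show "c *\<^sub>R x \<in> absorbed U"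
    using l unfolding absorbed_def by (auto intro!: exI[of _ "l * (\<bar>c\<bar> + 1)"])
qed

section \<open>A countable norming family\<close>

text \<open>The Minkowski sum of \<open>B\<close> and the closed ball of radius \<open>r\<close>
  about the origin.\<close>

definition thickening :: "real \<Rightarrow> 'a::real_normed_vector set \<Rightarrow> 'a set" where
  "thickening r B = {x. \<exists>b\<in>B. norm (x - b) \<le> r}"

lemma convex_thickening:
  assumes "convex B"
  shows "convex (thickening r B)"
proof (rule convexI)
  fix x y and u v :: real
  assume x: "x \<in> thickening r B" and y: "y \<in> thickening r B"
    and uv: "0 \<le> u" "0 \<le> v" "u + v = 1"
  obtain b c where b: "b \<in> B" "norm (x - b) \<le> r" and c: "c \<in> B" "norm (y - c) \<le> r"
    using x y by (auto simp: thickening_def)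
  have "norm ((u *\<^sub>R x + v *\<^sub>R y) - (u *\<^sub>R b + v *\<^sub>R c)) = norm (u *\<^sub>R (x - b) + v *\<^sub>R (y - c))"
    by (simp add: algebra_simps)
  also have "\<dots> \<le> u * norm (x - b) + v * norm (y - c)"
    using norm_triangle_ineq[of "u *\<^sub>R (x - b)" "v *\<^sub>R (y - c)"] uv by simp
  also have "\<dots> \<le> u * r + v * r"
    using b c uv by (intro add_mono mult_left_mono)
  also have "\<dots> = r"
    using uv by (metis distrib_right mult_1)
  finally show "u *\<^sub>R x + v *\<^sub>R y \<in> thickening r B"
    unfolding thickening_def using convexD[OF assms b(1) c(1) uv] by blast
qed

text \<open>Since \<open>0 \<in> B\<close>, the thickening contains the ball of radius
  \<open>r\<close>. It therefore absorbs the whole space, and its gauge is at most that of the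
  ball.\<close>

lemma
  assumes B: "convex B" "0 \<in> B" and r: "r > 0"
  shows absorbed_thickening: "absorbed (thickening r B) = UNIV"
    and sublinear_gauge_thickening: "sublinear (gauge_fun (thickening r B))"
    and gauge_thickening_le_norm: "gauge_fun (thickening r B) x \<le> norm x / r"
proof -
  have mem: "inverse l *\<^sub>R x \<in> thickening r B" if "l > 0" "norm x / r \<le> l" for l x
    using that r B by (auto simp: thickening_def field_simps intro!: bexI[of _ 0])
  have "x \<in> absorbed (thickening r B)" for x
  proof -
    have "norm x / r + 1 > 0" using r by (simp add: add_nonneg_pos)
    then show ?thesis using mem[of "norm x / r + 1" x] by (auto simp: absorbed_def)
  qed
  then show "absorbed (thickening r B) = UNIV" by blast
  moreover have "0 \<in> thickening r B"
    using r B by (auto simp: thickening_def intro!: bexI[of _ 0])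
  ultimately show sub: "sublinear (gauge_fun (thickening r B))"
    by (intro gauge_fun_sublinear convex_thickening B)
  show "gauge_fun (thickening r B) x \<le> norm x / r"
  proof (cases "x = 0")
    case False
    then show ?thesis using r mem[of "norm x / r" x] by (intro gauge_fun_le) auto
  qed (simp add: sublinear_zero[OF sub])
qed

lemma inter_thickening:
  assumes "closed B" "\<And>n. x \<in> thickening (1 / real (Suc n)) B"
  shows "x \<in> B"
proof -
  have "\<exists>y\<in>B. dist y x < e" if e: "e > 0" for e
  proof -
    obtain n where n: "inverse (real (Suc n)) < e"
      using reals_Archimedean[OF e] by blast
    obtain b where "b \<in> B" "norm (x - b) \<le> 1 / real (Suc n)"
      using assms(2)[of n] by (auto simp: thickening_def)
    then show ?thesis
      using n by (intro bexI[of _ b]) (auto simp: dist_norm norm_minus_commute inverse_eq_divide)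
  qed
  then show ?thesis
    using assms(1) closure_approachable[of x B] by simp
qed

text \<open>
  The gauge of \<open>B\<close> need not be norm continuous, but that of a thickening is, so it is attained
  up to \<open>\<epsilon>\<close> by functionals touching it at the points of a norm dense set.
\<close>

lemma countable_norming_family:
  fixes B :: "'a::real_normed_vector set"
  assumes B: "convex B" "0 \<in> B" "closed B" and sym: "\<And>x. x \<in> B \<Longrightarrow> - x \<in> B"
    and E: "countable E" "absorbed B \<subseteq> closure E"
  obtains F :: "nat \<Rightarrow> 'a \<Rightarrow> real" where "\<And>n. linear (F n)"
    "\<And>x n. x \<in> absorbed B \<Longrightarrow> \<bar>F n x\<bar> \<le> gauge_fun B x"
    "\<And>x s. x \<in> absorbed B \<Longrightarrow> (\<And>n. \<bar>F n x\<bar> \<le> s) \<Longrightarrow> gauge_fun B x \<le> s"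
proof -
  define p where "p k = gauge_fun (thickening (1 / real (Suc k)) B)" for k
  have p: "sublinear (p k)" for k
    unfolding p_def by (intro sublinear_gauge_thickening B) simp
  have p_norm: "p k x \<le> norm x * real (Suc k)" for k x
    using gauge_thickening_le_norm[OF B(1,2), of "1 / real (Suc k)" x] by (simp add: p_def)
  have p_minus: "p k (- x) = p k x" for k x
    unfolding p_def
  proof (rule gauge_fun_uminus)
    fix x assume "x \<in> thickening (1 / real (Suc k)) B"
    then obtain b where "b \<in> B" "norm (x - b) \<le> 1 / real (Suc k)"
      by (auto simp: thickening_def)
    then show "- x \<in> thickening (1 / real (Suc k)) B"
      unfolding thickening_def using sym[of b]
      by (auto simp: norm_minus_commute intro!: bexI[of _ "- b"])
  qed
  have p_le: "p k x \<le> gauge_fun B x" if "x \<in> absorbed B" for k x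
    unfolding p_def
    by (rule gauge_fun_antimono[OF _ that])
      (force simp: thickening_def)
  \<comment> \<open>Each \<open>p k\<close> is finite and sublinear on the whole space, so touching
    points may be taken outside \<open>absorbed B\<close>. This matters because \<open>E\<close>
    need not lie in \<open>absorbed B\<close>.\<close>
  have "\<exists>f. linear f \<and> (\<forall>x. f x \<le> p k x) \<and> f a = p k a" for k a
    using hahn_banach_touching[OF p, of k a] by metis
  then obtain G where G: "\<And>k a. linear (G k a)" "\<And>k a x. G k a x \<le> p k x"
    "\<And>k a. G k a a = p k a" by metis
  have G_abs: "\<bar>G k a x\<bar> \<le> p k x" for k a x
    using G(2)[of k a x] G(2)[of k a "- x"] by (simp add: p_minus linear_neg[OF G(1)])
  \<comment> \<open>One sequence runs through all pairs of a thickening index \<open>k\<close> and a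
    position \<open>m\<close> in the enumeration of \<open>E\<close>.\<close>
  define F where "F n = (case prod_decode n of (k, m) \<Rightarrow> G k (from_nat_into E m))" for n
  show thesis
  proof (rule that[of F])
    show "linear (F n)" for n
      by (simp add: F_def G(1) split: prod.split)
    show "\<bar>F n x\<bar> \<le> gauge_fun B x" if "x \<in> absorbed B" for n x
      using order_trans[OF G_abs p_le[OF that]] by (simp add: F_def split: prod.split)
    fix x s assume x: "x \<in> absorbed B" and s: "\<And>n. \<bar>F n x\<bar> \<le> s"
    have Gs: "G k a x \<le> s" if a: "a \<in> E" for k a
    proof -
      obtain m where "from_nat_into E m = a"
        using from_nat_into_surj[OF E(1) a] by blast
      then have "F (prod_encode (k, m)) = G k a" by (simp add: F_def)
      then show ?thesis using s[of "prod_encode (k, m)"] by simp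
    qed
    have p_s: "p k x \<le> s" for k
    proof (rule field_le_epsilon)
      fix e :: real assume "e > 0"
      \<comment> \<open>The error \<open>x - a\<close> is paid for twice, once in \<open>p k\<close>
        and once in \<open>G k a\<close>. Each time it costs at most \<open>p k (x - a)\<close>,
        which is below \<open>e / 2\<close> because \<open>p k\<close> is bounded by
        \<open>Suc k\<close> times the norm.\<close>
      then have "e / (2 * real (Suc k)) > 0" by simp
      moreover have "x \<in> closure E" using x E(2) by blast
      ultimately obtain a where a: "a \<in> E" "dist a x < e / (2 * real (Suc k))"
        unfolding closure_approachable by blast
      have d: "p k (x - a) < e/2"
      proof -
        have "p k (x - a) \<le> dist a x * real (Suc k)"
          using p_norm[of k "x - a"] by (simp add: dist_norm norm_minus_commute)
        also have "\<dots> < e/2" using a(2) by (simp add: field_simps)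
        finally show ?thesis .
      qed
      have "p k x \<le> p k a + p k (x - a)"
        using sublinear_add[OF p, of k a "x - a"] by simp
      also have "p k a = G k a x - G k a (x - a)"
        by (simp add: G(3) linear_diff[OF G(1)])
      also have "\<dots> \<le> s + p k (x - a)"
        using Gs[OF a(1), of k] G_abs[of k a "x - a"] by simp
      finally show "p k x \<le> s + e" using d by simp
    qed
    show "gauge_fun B x \<le> s"
    \<comment> \<open>A number \<open>t\<close> strictly above \<open>s\<close> is admissible for
      every thickening at once. As \<open>B\<close> is closed, it is then admissible for
      \<open>B\<close> itself.\<close>
    proof (rule dense_ge)
      fix t assume t: "s < t"
      have in_t: "0 < t \<and> inverse t *\<^sub>R x \<in> thickening (1 / real (Suc k)) B" for k
      proof -
        have "p k x < t" using p_s[of k] t by simp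
        moreover have "0 \<in> thickening (1 / real (Suc k)) B"
          using B(2) by (auto simp: thickening_def intro!: bexI[of _ 0])
        ultimately show ?thesis
          using gauge_fun_lessD[of "thickening (1 / real (Suc k)) B" x t] B
          by (simp add: p_def convex_thickening absorbed_thickening)
      qed
      show "gauge_fun B x \<le> t"
      proof (rule gauge_fun_le)
        show "0 < t" using in_t by blast
        show "inverse t *\<^sub>R x \<in> B"
          by (rule inter_thickening[OF B(3)]) (use in_t in blast)
      qed
    qed
  qed
qed

section \<open>Embedding into the bounded sequences\<close>

text \<open>Boundedness of \<open>B\<close> makes a gauge-Cauchy sequence norm-Cauchy, so it has a
  norm limit. Closedness of \<open>B\<close> makes this limit a limit in the gauge too, and the
  isometry carries it to the limit of the images.\<close>

lemma closed_isometric_image: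
  fixes B :: "'a::banach set" and T :: "'a \<Rightarrow> 'b::real_normed_vector"
  assumes B: "convex B" "0 \<in> B" "closed B" "bounded B" and sym: "\<And>x. x \<in> B \<Longrightarrow> - x \<in> B"
    and T_diff: "\<And>x y. x \<in> absorbed B \<Longrightarrow> y \<in> absorbed B \<Longrightarrow> T (x - y) = T x - T y"
    and T_norm: "\<And>x. x \<in> absorbed B \<Longrightarrow> norm (T x) = gauge_fun B x"
  shows "closed (T ` absorbed B)"
proof -
  let ?V = "absorbed B"
  have V: "subspace ?V"
    by (rule subspace_absorbed[OF B(1,2) sym])
  obtain M where M: "M > 0" "\<And>b. b \<in> B \<Longrightarrow> norm b \<le> M"
    using B(4) by (auto simp: bounded_pos)
  have "w \<in> T ` ?V" if s: "\<And>n. s n \<in> T ` ?V" "s \<longlonglongrightarrow> w" for s w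
  proof -
    have "\<forall>n. \<exists>v. v \<in> ?V \<and> s n = T v"
      using s(1) by blast
    then obtain x where x: "\<And>n. x n \<in> ?V" "\<And>n. s n = T (x n)"
      using choice[of "\<lambda>n v. v \<in> ?V \<and> s n = T v"] by blast
    have close: "\<exists>N. \<forall>m\<ge>N. \<forall>n\<ge>N. inverse e *\<^sub>R (x m - x n) \<in> B" if e: "e > 0" for e
    proof -
      obtain N where N: "\<And>m n. m \<ge> N \<Longrightarrow> n \<ge> N \<Longrightarrow> norm (s m - s n) < e"
        using CauchyD[OF LIMSEQ_imp_Cauchy[OF s(2)] e] by blast
      have "inverse e *\<^sub>R (x m - x n) \<in> B" if "m \<ge> N" "n \<ge> N" for m n
      proof (rule gauge_fun_lessD[OF B(1,2)])
        show v: "x m - x n \<in> ?V" using x(1) V by (intro subspace_diff)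
        show "gauge_fun B (x m - x n) < e"
          using N[OF that] x by (simp add: T_norm[OF v, symmetric] T_diff)
      qed
      then show ?thesis by blast
    qed
    have "Cauchy x"
    proof (rule CauchyI)
      fix e :: real assume e: "e > 0"
      \<comment> \<open>As \<open>B\<close> lies in the ball of radius \<open>M\<close>, gauge
        accuracy \<open>e / (2 * M)\<close> gives norm accuracy \<open>e / 2\<close>.\<close>
      then obtain N where N: "\<forall>m\<ge>N. \<forall>n\<ge>N. inverse (e / (2 * M)) *\<^sub>R (x m - x n) \<in> B"
        using close[of "e / (2 * M)"] M by auto
      have "norm (x m - x n) < e" if "m \<ge> N" "n \<ge> N" for m n
      proof -
        have "norm (inverse (e / (2 * M)) *\<^sub>R (x m - x n)) \<le> M"
          using N that M(2) by blast
        then have "norm (x m - x n) \<le> e / 2"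
          using e M(1) unfolding norm_scaleR by (simp add: field_simps)
        then show ?thesis using e by simp
      qed
      then show "\<exists>N. \<forall>m\<ge>N. \<forall>n\<ge>N. norm (x m - x n) < e" by blast
    qed
    then obtain z where z: "x \<longlonglongrightarrow> z"
      using Cauchy_convergent convergent_def by blast
    \<comment> \<open>For fixed \<open>m\<close> let \<open>n\<close> tend to infinity in
      \<open>close\<close>; closedness of \<open>B\<close> preserves the membership.\<close>
    have close_z: "\<exists>N. \<forall>m\<ge>N. inverse e *\<^sub>R (x m - z) \<in> B" if "e > 0" for e
    proof -
      obtain N where N: "\<forall>m\<ge>N. \<forall>n\<ge>N. inverse e *\<^sub>R (x m - x n) \<in> B"
        using close[OF \<open>e > 0\<close>] by blast
      have "inverse e *\<^sub>R (x m - z) \<in> B" if "m \<ge> N" for m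
      proof (rule Lim_in_closed_set[OF B(3)])
        show "(\<lambda>n. inverse e *\<^sub>R (x m - x n)) \<longlonglongrightarrow> inverse e *\<^sub>R (x m - z)"
          by (intro tendsto_intros z)
        show "\<forall>\<^sub>F n in sequentially. inverse e *\<^sub>R (x m - x n) \<in> B"
          using N that eventually_sequentially by blast
      qed simp
      then show ?thesis by blast
    qed
    have "z \<in> ?V"
    proof -
      obtain N where "inverse 1 *\<^sub>R (x N - z) \<in> B"
        using close_z[of 1] by auto
      then have "x N - z \<in> ?V"
        unfolding absorbed_def using zero_less_one by blast
      then have "x N - (x N - z) \<in> ?V"
        by (rule subspace_diff[OF V x(1)])
      then show ?thesis by simp
    qed
    have "s \<longlonglongrightarrow> T z"
    proof (rule LIMSEQ_I)
      fix e :: real assume e: "e > 0"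
      then obtain N where N: "\<forall>m\<ge>N. inverse (e / 2) *\<^sub>R (x m - z) \<in> B"
        using close_z[of "e / 2"] by auto
      have "norm (s m - T z) < e" if "m \<ge> N" for m
      proof -
        have "x m - z \<in> ?V" using x(1) \<open>z \<in> ?V\<close> V by (intro subspace_diff)
        then have "norm (s m - T z) = gauge_fun B (x m - z)"
          using x \<open>z \<in> ?V\<close> by (simp add: T_norm[symmetric] T_diff)
        also have "\<dots> \<le> e / 2"
          using e N that by (intro gauge_fun_le) auto
        finally show ?thesis using e by simp
      qed
      then show "\<exists>N. \<forall>m\<ge>N. norm (s m - T z) < e" by blast
    qed
    then have "w = T z"
      using s(2) LIMSEQ_unique by blast
    then show ?thesis using \<open>z \<in> ?V\<close> by blast
  qed
  then show ?thesis
    unfolding closed_sequential_limits by blast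
qed

text \<open>Evaluating the norming family at \<open>x\<close> gives a bounded sequence whose
  supremum norm is the gauge of \<open>x\<close>.\<close>

lemma gauge_space_embeds:
  fixes B :: "'a::banach set"
  assumes B: "convex B" "0 \<in> B" "closed B" "bounded B" and sym: "\<And>x. x \<in> B \<Longrightarrow> - x \<in> B"
    and E: "countable E" "absorbed B \<subseteq> closure E"
  shows "\<exists>W :: l_infinity set. closed W \<and> linearly_isometric (absorbed B) (gauge_fun B) W"
proof -
  let ?V = "absorbed B"
  have V: "subspace ?V"
    by (rule subspace_absorbed[OF B(1,2) sym])
  obtain F :: "nat \<Rightarrow> 'a \<Rightarrow> real" where F: "\<And>n. linear (F n)"
    "\<And>x n. x \<in> ?V \<Longrightarrow> \<bar>F n x\<bar> \<le> gauge_fun B x"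
    "\<And>x s. x \<in> ?V \<Longrightarrow> (\<And>n. \<bar>F n x\<bar> \<le> s) \<Longrightarrow> gauge_fun B x \<le> s"
    using countable_norming_family[OF B(1-3) sym E] by metis
  \<comment> \<open>Outside \<open>?V\<close> the sequence may be unbounded and the value of
    \<open>Bcontfun\<close> unspecified, so every fact about \<open>T\<close> is restricted to
    \<open>?V\<close>.\<close>
  define T :: "'a \<Rightarrow> l_infinity" where "T x = Bcontfun (\<lambda>n. F n x)" for x
  have T: "apply_bcontfun (T x) n = F n x" if "x \<in> ?V" for x n
  proof -
    have "(\<lambda>n. F n x) \<in> bcontfun"
      unfolding bcontfun_def bounded_iff using F(2)[OF that] by auto
    then show ?thesis by (simp add: T_def Bcontfun_inverse)
  qed
  have T_add: "T (x + y) = T x + T y" if "x \<in> ?V" "y \<in> ?V" for x y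
    using that subspace_add[OF V that]
    by (intro bcontfun_eqI) (simp add: T linear_add[OF F(1)])
  have T_scale: "T (c *\<^sub>R x) = c *\<^sub>R T x" if "x \<in> ?V" for c x
    using that subspace_scale[OF V that]
    by (intro bcontfun_eqI) (simp add: T linear_scale[OF F(1)])
  have T_diff: "T (x - y) = T x - T y" if "x \<in> ?V" "y \<in> ?V" for x y
    using that subspace_diff[OF V that]
    by (intro bcontfun_eqI) (simp add: T linear_diff[OF F(1)])
  have T_norm: "norm (T x) = gauge_fun B x" if x: "x \<in> ?V" for x
  proof (rule antisym)
    show "norm (T x) \<le> gauge_fun B x"
      by (rule norm_bound) (simp add: T[OF x] F(2)[OF x])
    show "gauge_fun B x \<le> norm (T x)"
      by (rule F(3)[OF x]) (metis T[OF x] norm_bounded real_norm_def)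
  qed
  have "subspace (T ` ?V)"
  proof (rule subspaceI)
    show "0 \<in> T ` ?V"
      using T_scale[OF subspace_0[OF V], of 0] subspace_0[OF V] by (metis image_eqI scale_zero_left)
  next
    fix x y assume "x \<in> T ` ?V" "y \<in> T ` ?V"
    then obtain u v where "u \<in> ?V" "v \<in> ?V" "x = T u" "y = T v" by blast
    then show "x + y \<in> T ` ?V"
      using T_add[of u v] subspace_add[OF V, of u v] by (intro image_eqI[of _ T "u + v"]) auto
  next
    fix c x assume "x \<in> T ` ?V"
    then obtain u where "u \<in> ?V" "x = T u" by blast
    then show "c *\<^sub>R x \<in> T ` ?V"
      using T_scale[of u c] subspace_scale[OF V, of u c] by (intro image_eqI[of _ T "c *\<^sub>R u"]) auto
  qed
  moreover have "closed (T ` ?V)"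
    by (rule closed_isometric_image[OF B sym T_diff T_norm])
  ultimately show ?thesis
    unfolding linearly_isometric_def using V T_add T_scale T_norm by blast
qed

section \<open>Generating spaces\<close>

definition symmetric_part :: "'a::real_vector set \<Rightarrow> 'a \<Rightarrow> 'a set" where
  "symmetric_part C e = (\<lambda>c. c - e) ` C \<inter> (\<lambda>c. e - c) ` C"

lemma mem_symmetric_part: "x \<in> symmetric_part C e \<longleftrightarrow> e + x \<in> C \<and> e - x \<in> C"
proof -
  have "x \<in> (\<lambda>c. c - e) ` C \<longleftrightarrow> e + x \<in> C"
    by (metis (no_types, lifting) add_diff_cancel_left' add_diff_eq image_iff diff_add_cancel add.commute)
  moreover have "x \<in> (\<lambda>c. e - c) ` C \<longleftrightarrow> e - x \<in> C"
    by (auto simp: image_iff intro!: bexI[of _ "e - x"])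
  ultimately show ?thesis by (simp add: symmetric_part_def)
qed

lemma generating_norm_eq_gauge: "generating_norm C e = gauge_fun (symmetric_part C e)"
  by (simp add: fun_eq_iff generating_norm_def gauge_fun_def symmetric_part_def)

lemma symmetric_part_props:
  fixes C :: "'a::real_normed_vector set"
  assumes "closed C" "bounded C" "convex C" "e \<in> C"
  shows "convex (symmetric_part C e)" "0 \<in> symmetric_part C e"
    "closed (symmetric_part C e)" "bounded (symmetric_part C e)"
    "\<And>x. x \<in> symmetric_part C e \<Longrightarrow> - x \<in> symmetric_part C e"
proof -
  have eq: "(\<lambda>c. c - e) ` C = (\<lambda>c. - e + c) ` C" "(\<lambda>c. e - c) ` C = (\<lambda>c. e + c) ` uminus ` C"
    by (auto simp: image_image)
  show "convex (symmetric_part C e)"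
    unfolding symmetric_part_def eq
    by (intro convex_Int convex_translation convex_negations assms)
  show "closed (symmetric_part C e)"
    unfolding symmetric_part_def eq
    by (intro closed_Int closed_translation closed_negations assms)
  show "bounded (symmetric_part C e)"
    unfolding symmetric_part_def eq
    by (intro bounded_Int disjI1 bounded_translation assms)
qed (use assms in \<open>auto simp: mem_symmetric_part\<close>)

text \<open>Membership of \<open>x\<close> and of \<open>- x\<close> in the cone may use different
  scalars \<open>l\<close> and \<open>m\<close>. As \<open>C - e\<close> is convex and contains 0,
  the common scalar \<open>l + m\<close> serves for both.\<close>

lemma generating_space_eq_absorbed:
  assumes "convex C" "e \<in> C"
  shows "generating_space C e = absorbed (symmetric_part C e)"
proof -
  let ?D = "(\<lambda>c. c - e) ` C"
  have cone: "generated_cone C e = absorbed ?D"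
  proof -
    have "x \<in> generated_cone C e \<longleftrightarrow> (\<exists>l>0. \<exists>c\<in>C. x = l *\<^sub>R (c - e))" for x
      by (auto simp: generated_cone_def)
    moreover have "x = l *\<^sub>R y \<longleftrightarrow> inverse l *\<^sub>R x = y" if "l > 0" for l :: real and x y :: 'a
      using that by auto
    ultimately show ?thesis
      unfolding absorbed_def image_iff by (auto simp: set_eq_iff)
  qed
  have "convex ((\<lambda>c. - e + c) ` C)"
    by (rule convex_translation[OF assms(1)])
  then have D: "convex ?D" "0 \<in> ?D"
    using assms(2) by (auto simp: image_iff)
  have sym: "x \<in> symmetric_part C e \<longleftrightarrow> x \<in> ?D \<and> - x \<in> ?D" for x
  proof -
    have "x \<in> (\<lambda>c. e - c) ` C \<longleftrightarrow> - x \<in> ?D"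
      by (auto simp: image_iff minus_equation_iff[of x])
    then show ?thesis by (simp add: symmetric_part_def)
  qed
  have "x \<in> absorbed (symmetric_part C e)" if "x \<in> absorbed ?D" "- x \<in> absorbed ?D" for x
  proof -
    obtain l m where l: "l > 0" "inverse l *\<^sub>R x \<in> ?D" and m: "m > 0" "inverse m *\<^sub>R (- x) \<in> ?D"
      using \<open>x \<in> absorbed ?D\<close> \<open>- x \<in> absorbed ?D\<close> unfolding absorbed_def by blast
    \<comment> \<open>Adding the zero vector, taken with the other scalar, enlarges each scalar to
      the sum.\<close>
    have "inverse (l + m) *\<^sub>R (x + 0) \<in> ?D" "inverse (m + l) *\<^sub>R (- x + 0) \<in> ?D"
      using D(2) by (intro convex_inverse_scale_add[OF D(1)] l m; simp)+
    then show ?thesis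
      using l m unfolding absorbed_def by (auto simp: sym add.commute intro!: exI[of _ "l + m"])
  qed
  moreover have "x \<in> absorbed ?D \<and> - x \<in> absorbed ?D" if "x \<in> absorbed (symmetric_part C e)" for x
    using that by (auto simp: absorbed_def sym)
  moreover have "x \<in> uminus ` absorbed ?D \<longleftrightarrow> - x \<in> absorbed ?D" for x
    by (metis (no_types, lifting) add.inverse_inverse image_iff)
  ultimately show ?thesis
    unfolding generating_space_def cone by blast
qed

text \<open>The cone consists of values of a continuous map of a scalar and a point of
  \<open>C\<close>, so rational scalars and points of \<open>S\<close> suffice. The approximation is
  in the ambient norm; in \<open>generating_norm C e\<close> the space may fail to be
  separable.\<close>

lemma generating_space_separable:
  fixes C :: "'a::real_normed_vector set"
  assumes S: "countable S" "C \<subseteq> closure S"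
  shows "\<exists>E. countable E \<and> generating_space C e \<subseteq> closure E"
proof (intro exI conjI)
  let ?g = "\<lambda>p::real \<times> 'a. fst p *\<^sub>R (snd p - e)"
  show "countable (?g ` (\<rat> \<times> S))"
    using S by (simp add: countable_rat)
  have "generating_space C e \<subseteq> ?g ` closure (\<rat> \<times> S)"
    using S(2) by (force simp: generating_space_def generated_cone_def closure_Times Rats_closure_real)
  also have "\<dots> \<subseteq> closure (?g ` (\<rat> \<times> S))"
    by (intro image_closure_subset continuous_intros closure_subset) auto
  finally show "generating_space C e \<subseteq> closure (?g ` (\<rat> \<times> S))" .
qed

section \<open>Existence of nonsupport points\<close>

lemma separable_subset_dense:
  fixes C :: "'a::topological_space set"
  assumes "separable_space (top_of_set C)"
  obtains S where "countable S" "S \<subseteq> C" "C \<subseteq> closure S"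
proof -
  obtain S where S: "countable S" "S \<subseteq> C" "top_of_set C closure_of S = C"
    using assms unfolding separable_space_def by auto
  then have "C \<subseteq> closure S"
    using closure_of_subtopology_subset[of euclidean C S] by simp
  with S that show thesis by blast
qed

text \<open>Only the behaviour of \<open>f\<close> on \<open>S\<close> is controlled, so the
  sequence, its limit and their differences must all lie in \<open>S\<close>.\<close>

lemma bounded_functional_on_tendsto:
  assumes f: "bounded_functional_on S f" and S: "subspace S"
    and x: "\<And>n. x n \<in> S" "x \<longlonglongrightarrow> z" "z \<in> S"
  shows "(\<lambda>n. f (x n)) \<longlonglongrightarrow> f z"
proof -
  obtain K where K: "\<And>v. v \<in> S \<Longrightarrow> \<bar>f v\<bar> \<le> K * norm v"
    using f unfolding bounded_functional_on_def by blast
  have bound: "norm (f (x n) - f z) \<le> K * norm (x n - z)" for n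
  proof -
    have d: "x n - z \<in> S" using x S by (intro subspace_diff)
    then have "f ((x n - z) + z) = f (x n - z) + f z"
      using f x(3) unfolding bounded_functional_on_def by blast
    then show ?thesis using K[OF d] by simp
  qed
  have "(\<lambda>n. K * norm (x n - z)) \<longlonglongrightarrow> K * norm (z - z)"
    by (intro tendsto_intros x)
  then have "(\<lambda>n. K * norm (x n - z)) \<longlonglongrightarrow> 0" by simp
  then have "(\<lambda>n. f (x n) - f z) \<longlonglongrightarrow> 0"
    by (rule Lim_null_comparison[rotated]) (rule always_eventually, rule allI, rule bound)
  then show ?thesis by (simp add: LIM_zero_iff)
qed

text \<open>Putting the weight \<open>(1/2) ^ N\<close> missing from the \<open>N\<close>-th partial
  sum on any point of \<open>C\<close> gives a convex combination of points of \<open>C\<close>.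
  These combinations converge to the sum of the series.\<close>

lemma dyadic_sum_mem:
  fixes C :: "'a::banach set"
  assumes C: "closed C" "bounded C" "convex C" and c: "\<And>n. c n \<in> C"
  obtains e where "e \<in> C" "(\<lambda>n. (1/2) ^ Suc n *\<^sub>R c n) sums e"
proof -
  obtain M where M: "\<And>x. x \<in> C \<Longrightarrow> norm x \<le> M"
    using C(2) by (auto simp: bounded_iff)
  have "summable (\<lambda>n. (1/2) ^ Suc n *\<^sub>R c n)"
  proof (rule summable_comparison_test')
    show "summable (\<lambda>n. M * (1/2) ^ Suc n)"
      by (intro summable_mult) (simp add: summable_mult summable_geometric)
    show "norm ((1/2) ^ Suc n *\<^sub>R c n) \<le> M * (1/2) ^ Suc n" for n
      using M[OF c, of n] by (simp add: field_simps)
  qed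
  then obtain e where e: "(\<lambda>n. (1/2) ^ Suc n *\<^sub>R c n) sums e"
    by (auto simp: summable_def)
  have partial: "(\<Sum>n<N. (1/2) ^ Suc n *\<^sub>R c n) + (1/2) ^ N *\<^sub>R x \<in> C" if "x \<in> C" for N x
    using that
  proof (induction N arbitrary: x)
    case (Suc N)
    \<comment> \<open>The residual point is replaced by its midpoint with \<open>c N\<close>, which
      is why the induction is over arbitrary \<open>x\<close>.\<close>
    have "(1/2) *\<^sub>R c N + (1/2) *\<^sub>R x \<in> C"
      using Suc.prems c by (intro convexD[OF C(3)]) auto
    from Suc.IH[OF this] show ?case
      by (simp add: algebra_simps)
  qed simp
  have "(\<lambda>N. (\<Sum>n<N. (1/2) ^ Suc n *\<^sub>R c n) + (1/2) ^ N *\<^sub>R c 0) \<longlonglongrightarrow> e + 0 *\<^sub>R c 0"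
    using e unfolding sums_def by (intro tendsto_intros LIMSEQ_power_zero) auto
  then have "(\<lambda>N. (\<Sum>n<N. (1/2) ^ Suc n *\<^sub>R c n) + (1/2) ^ N *\<^sub>R c 0) \<longlonglongrightarrow> e"
    by simp
  then have "e \<in> C"
    by (rule closed_sequentially[OF C(1) partial[OF c]])
  then show thesis using that e by blast
qed

text \<open>The weights are positive and sum to 1. At a maximum the gaps
  \<open>f e - f (c n)\<close> are nonnegative with weighted sum 0, so all of them vanish.\<close>

lemma dyadic_sum_not_support_point:
  assumes dense: "C \<subseteq> closure (range c)" and c: "\<And>n. c n \<in> C"
    and e: "e \<in> C" "(\<lambda>n. (1/2) ^ Suc n *\<^sub>R c n) sums e"
  shows "\<not> support_point C e"
proof
  let ?S = "closed_span C"
  have S: "subspace ?S" by (rule subspace_closed_span)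
  have CS: "C \<subseteq> ?S"
    unfolding closed_span_def by (meson closure_subset order_trans span_superset)
  assume "support_point C e"
  then obtain f y where f: "bounded_functional_on ?S f" and y: "y \<in> C" "f y \<noteq> f e"
    and max: "\<And>y. y \<in> C \<Longrightarrow> f y \<le> f e"
    unfolding support_point_def by blast
  have add: "f (x + y) = f x + f y" if "x \<in> ?S" "y \<in> ?S" for x y
    using f that unfolding bounded_functional_on_def by blast
  have scale: "f (t *\<^sub>R x) = t * f x" if "x \<in> ?S" for t x
    using f that unfolding bounded_functional_on_def by blast
  have partial: "(\<Sum>n<N. (1/2) ^ Suc n *\<^sub>R c n) \<in> ?S" for N
    using c CS by (intro subspace_sum[OF S] subspace_scale[OF S]) auto
  have f_partial: "f (\<Sum>n<N. (1/2) ^ Suc n *\<^sub>R c n) = (\<Sum>n<N. (1/2) ^ Suc n * f (c n))" for N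
  proof (induction N)
    case (Suc N)
    have cN: "c N \<in> ?S" using c CS by blast
    show ?case
      using Suc.IH add[OF partial[of N] subspace_scale[OF S cN]] scale[OF cN] by simp
  qed (simp add: bounded_functional_on_0[OF f])
  have "(\<lambda>N. f (\<Sum>n<N. (1/2) ^ Suc n *\<^sub>R c n)) \<longlonglongrightarrow> f e"
    using e CS by (intro bounded_functional_on_tendsto[OF f S partial]) (auto simp: sums_def)
  then have "(\<lambda>n. (1/2) ^ Suc n * f (c n)) sums f e"
    by (simp only: sums_def f_partial)
  moreover have "(\<lambda>n. (1/2) ^ Suc n * f e) sums (1 * f e)"
    using power_half_series by (rule sums_mult2)
  ultimately have "(\<lambda>n. (1/2) ^ Suc n * f e - (1/2) ^ Suc n * f (c n)) sums (1 * f e - f e)"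
    by (rule sums_diff[rotated])
  then have gap: "(\<lambda>n. (1/2) ^ Suc n * (f e - f (c n))) sums 0"
    by (simp add: right_diff_distrib)
  have f_c: "f (c n) = f e" for n
  proof -
    have "0 \<le> (1/2) ^ Suc m * (f e - f (c m))" for m
      using max[OF c, of m] by simp
    from suminf_eq_zero_iff[OF sums_summable[OF gap] this] sums_unique[OF gap]
    have "(1/2) ^ Suc n * (f e - f (c n)) = 0" by (simp only: simp_thms)
    then show ?thesis by simp
  qed
  \<comment> \<open>Density and continuity carry the common value from the \<open>c n\<close> to
    \<open>y\<close>, against the choice of \<open>y\<close>.\<close>
  have "y \<in> closure (range c)"
    using dense y(1) by blast
  then obtain s where s: "\<And>n. s n \<in> range c" "s \<longlonglongrightarrow> y"
    unfolding closure_sequential by blast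
  have "s n \<in> ?S" for n
    using s(1)[of n] c CS by auto
  then have "(\<lambda>n. f (s n)) \<longlonglongrightarrow> f y"
    using CS y(1) by (intro bounded_functional_on_tendsto[OF f S _ s(2)]) auto
  moreover have "f (s n) = f e" for n
    using s(1)[of n] f_c by auto
  ultimately have "f y = f e"
    by (simp add: LIMSEQ_const_iff)
  with y(2) show False by blast
qed

theorem theorem4:
  fixes C :: "'a::banach set"
  assumes "closed C" and "bounded C" and "convex C"
    and "\<exists>x\<in>C. \<exists>y\<in>C. x \<noteq> y"
    and "separable_space (top_of_set C)"
  shows "nonsupport_points C \<noteq> {} \<and>
    (\<forall>e\<in>nonsupport_points C. \<exists>W :: l_infinity set.
       closed W \<and> linearly_isometric (generating_space C e) (generating_norm C e) W)"
proof (intro conjI ballI)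
  obtain S where S: "countable S" "S \<subseteq> C" "C \<subseteq> closure S"
    using separable_subset_dense[OF assms(5)] by metis
  \<comment> \<open>Nonemptiness lets \<open>from_nat_into S\<close> enumerate \<open>S\<close>.
    Repetitions, unavoidable for finite \<open>S\<close>, are harmless because only the range of the
    sequence has to be dense.\<close>
  have "S \<noteq> {}" using S(3) assms(4) by auto
  then have range: "range (from_nat_into S) = S"
    using S(1) by (simp add: range_from_nat_into)
  have c: "from_nat_into S n \<in> C" for n
    using from_nat_into[OF \<open>S \<noteq> {}\<close>] S(2) by blast
  obtain e where e: "e \<in> C" "(\<lambda>n. (1/2) ^ Suc n *\<^sub>R from_nat_into S n) sums e"
    by (rule dyadic_sum_mem[OF assms(1-3) c])
  have "\<not> support_point C e"
    using S(3) range by (intro dyadic_sum_not_support_point[OF _ c e]) simp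
  then show "nonsupport_points C \<noteq> {}"
    using e(1) by (auto simp: nonsupport_points_def)
next
  fix e assume "e \<in> nonsupport_points C"
  then have e: "e \<in> C" by (simp add: nonsupport_points_def)
  obtain S where S: "countable S" "C \<subseteq> closure S"
    using separable_subset_dense[OF assms(5)] by metis
  obtain E where E: "countable E" "generating_space C e \<subseteq> closure E"
    using generating_space_separable[OF S] by blast
  note B = symmetric_part_props[OF assms(1-3) e]
  have "absorbed (symmetric_part C e) \<subseteq> closure E"
    using E(2) generating_space_eq_absorbed[OF assms(3) e] by simp
  from gauge_space_embeds[OF B(1-5) E(1) this]
  show "\<exists>W :: l_infinity set. closed W \<and>
      linearly_isometric (generating_space C e) (generating_norm C e) W"
    by (simp add: generating_space_eq_absorbed[OF assms(3) e] generating_norm_eq_gauge)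
qed

end
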